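(* Let $E$ be a Banach lattice. For a point $x\in\mathrm{fin}({}^*E)$ the following are equivalent: (1) $x\in\mu_d(0)$; (2) $\hat{x}\in E^d$; (3) $x$ is nearly disjoint with every $y\in E_+$, i.e., $|x|\wedge y\approx 0$ for every $y\in E_+$. Here $\mu_d(0)$ is the monad of zero for the d-topology of $E$ and $E^d$ is the disjoint complement of $E$ in the nonstandard hull $\widehat E$.
   Context: Nonstandard hull: work in a nonstandard universe which is sufficiently saturated (any family of internal sets indexed by a standard set and having the finite intersection property has nonempty intersection). ${}^*E$ is the nonstandard extension of $E$. $\mathrm{fin}({}^*E)$ is the set of elements of ${}^*E$ of finite norm, $\mu(0)$ the set of elements of infinitesimal norm, and $\widehat E=\mathrm{fin}({}^*E)/\mu(0)$; $\hat x$ is the class of $x$, and $\|\hat x\|$ is the standard part of $\|x\|$. $\widehat E$ is a Banach lattice with $|\hat x|=\widehat{|x|}$, and $E$ is identified with a closed subspace of $\widehat E$ via $x\mapsto\hat x$. For $x,y\in{}^*E$, $x\approx y$ means that $\|x-y\|$ is infinitesimal. $E_+$ denotes the (standard) positive cone of $E$. d-topology: a net $(x_\alpha)$ in $E$ d-converges to $x\in E$ if $\||x_\alpha-x|\wedge y\|\to0$ for every $y\in E_+$; the topology generated by this convergence is the d-topology of $E$ (a base of neighbourhoods of $0$ is given by finite intersections of the sets $\{x\in E:\||x|\wedge y\|<\varepsilon\}$, $y\in E_+$, $\varepsilon>0$). $\mu_d(0)=\bigcap {}^*U$, over all (standard) d-neighbourhoods $U$ of $0$ in $E$. $E^d=\{\xi\in\widehat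 E: |\xi|\wedge|\hat y|=0\text{ for all }y\in E\}$. *)

theory Defs
  imports "HOL-Analysis.Analysis" "HOL-Library.Lattice_Algebras"
begin

section \<open>Banach lattices\<close>

class banach_lattice = banach + ordered_real_vector + lattice_ab_group_add_abs +
  assumes norm_mono: "\<bar>x\<bar> \<le> \<bar>y\<bar> \<Longrightarrow> norm x \<le> norm y"

instance real :: banach_lattice
  by standard (auto simp: sup_real_def)


section \<open>The d-topology\<close>

text \<open>Convergence of nets is expressed through filters: a net converges iff its
  eventuality filter does, and every filter is the eventuality filter of a net.\<close>

definition d_converges :: "'e::banach_lattice filter \<Rightarrow> 'e \<Rightarrow> bool" where
  "d_converges F x \<longleftrightarrow> (\<forall>y\<ge>0. ((\<lambda>z. norm (inf \<bar>z - x\<bar> y)) \<longlongrightarrow> 0) F)"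

definition d_open :: "'e::banach_lattice set \<Rightarrow> bool" where
  "d_open U \<longleftrightarrow> (\<forall>x\<in>U. \<forall>F. d_converges F x \<longrightarrow> eventually (\<lambda>z. z \<in> U) F)"

definition d_topology :: "'e::banach_lattice topology" where
  "d_topology = topology d_open"

lemma openin_d_topology: "openin d_topology (U :: 'e::banach_lattice set) \<longleftrightarrow> d_open U"
proof -
  have "istopology (d_open :: 'e set \<Rightarrow> bool)"
    unfolding istopology_def
  proof (intro conjI allI impI)
    fix S T :: "'e set" assume "d_open S" "d_open T"
    then show "d_open (S \<inter> T)"
      unfolding d_open_def by (auto intro: eventually_conj)
  next
    fix \<K> :: "'e set set" assume K: "\<forall>K\<in>\<K>. d_open K"
    show "d_open (\<Union>\<K>)"
      unfolding d_open_def
    proof (intro ballI allI impI)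
      fix x F assume "x \<in> \<Union>\<K>" and F: "d_converges F x"
      then obtain K where "K \<in> \<K>" "x \<in> K" by blast
      with K F have "eventually (\<lambda>z. z \<in> K) F" by (auto simp: d_open_def)
      then show "eventually (\<lambda>z. z \<in> \<Union>\<K>) F"
        by (rule eventually_mono) (use \<open>K \<in> \<K>\<close> in blast)
    qed
  qed
  then show ?thesis by (simp add: d_topology_def)
qed

definition d_neighbourhood_0 :: "'e::banach_lattice set \<Rightarrow> bool" where
  "d_neighbourhood_0 U \<longleftrightarrow> (\<exists>V. openin d_topology V \<and> 0 \<in> V \<and> V \<subseteq> U)"

lemma inf_add_le_inf:
  fixes a b y :: "'e::lattice_ab_group_add"
  assumes "0 \<le> a" "0 \<le> b" "0 \<le> y"
  shows "inf (a + b) y \<le> inf a y + inf b y"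
proof -
  let ?w = "inf (a + b) y"
  have "?w \<le> y + a" by (rule order_trans[OF inf_le2]) (simp add: assms)
  then have "?w - a \<le> inf b y" by (simp add: diff_le_eq add.commute)
  moreover have "?w - y \<le> inf b y"
    by (rule order_trans[of _ 0]) (simp_all add: assms)
  ultimately have "?w - inf b y \<le> a" "?w - inf b y \<le> y"
    by (metis diff_le_eq add.commute)+
  then have "?w - inf b y \<le> inf a y" by (rule le_infI)
  then show ?thesis by (rule iffD1[OF diff_le_eq])
qed

lemma d_neighbourhood_0_iff:
  "d_neighbourhood_0 (U :: 'e::banach_lattice set) \<longleftrightarrow>
     (\<exists>Y \<epsilon>. finite Y \<and> Y \<subseteq> {0..} \<and> \<epsilon> > 0 \<and> {x. \<forall>y\<in>Y. norm (inf \<bar>x\<bar> y) < \<epsilon>} \<subseteq> U)"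
proof
  assume "d_neighbourhood_0 U"
  then obtain V where V: "d_open V" "0 \<in> V" "V \<subseteq> U"
    by (auto simp: d_neighbourhood_0_def openin_d_topology)
  define B where "B = (\<lambda>(y::'e, \<epsilon>::real). {x. norm (inf \<bar>x\<bar> y) < \<epsilon>})"
  define I where "I = {0::'e..} \<times> {0::real<..}"
  define F where "F = (INF i\<in>I. principal (B i))"
  have "d_converges F 0"
    unfolding d_converges_def
  proof (intro allI impI tendstoI)
    fix y :: 'e and e :: real assume "0 \<le> y" "0 < e"
    then have "(y, e) \<in> I" by (simp add: I_def)
    then have "F \<le> principal (B (y, e))" unfolding F_def by (rule INF_lower)
    then show "eventually (\<lambda>z. dist (norm (inf \<bar>z - 0\<bar> y)) 0 < e) F"
      by (auto simp: le_principal B_def)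
  qed
  then have "eventually (\<lambda>z. z \<in> V) F" using V by (auto simp: d_open_def)
  then have "\<exists>X\<subseteq>I. finite X \<and> eventually (\<lambda>z. z \<in> V) (INF i\<in>X. principal (B i))"
    unfolding F_def by (rule iffD1[OF eventually_INF])
  then obtain X where X: "finite X" "X \<subseteq> I"
    and ev: "eventually (\<lambda>z. z \<in> V) (INF i\<in>X. principal (B i))"
    by blast
  from ev have sub: "(\<Inter>i\<in>X. B i) \<subseteq> V"
    unfolding INF_principal_finite[OF X(1)] eventually_principal by blast
  let ?e = "Min (insert 1 (snd ` X))"
  have pos: "?e > 0" using X by (auto simp: I_def)
  have "{x. \<forall>y\<in>fst ` X. norm (inf \<bar>x\<bar> y) < ?e} \<subseteq> (\<Inter>i\<in>X. B i)"
  proof (intro subsetI INT_I)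
    fix x i assume x: "x \<in> {x. \<forall>y\<in>fst ` X. norm (inf \<bar>x\<bar> y) < ?e}" and i: "i \<in> X"
    then have "norm (inf \<bar>x\<bar> (fst i)) < ?e" by blast
    also have "?e \<le> snd i" using X i by (intro Min_le) auto
    finally show "x \<in> B i" by (simp add: B_def case_prod_beta)
  qed
  then have "{x. \<forall>y\<in>fst ` X. norm (inf \<bar>x\<bar> y) < ?e} \<subseteq> U" using sub V by (meson order_trans)
  moreover have "finite (fst ` X)" "fst ` X \<subseteq> {0..}" using X by (auto simp: I_def)
  ultimately show "\<exists>Y \<epsilon>. finite Y \<and> Y \<subseteq> {0..} \<and> \<epsilon> > 0 \<and> {x. \<forall>y\<in>Y. norm (inf \<bar>x\<bar> y) < \<epsilon>} \<subseteq> U"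
    using pos by blast
next
  assume "\<exists>Y \<epsilon>. finite Y \<and> Y \<subseteq> {0..} \<and> \<epsilon> > 0 \<and> {x. \<forall>y\<in>Y. norm (inf \<bar>x\<bar> y) < \<epsilon>} \<subseteq> U"
  then obtain Y and e :: real where Y: "finite Y" "Y \<subseteq> {0..}" "e > 0"
    and sub: "{x. \<forall>y\<in>Y. norm (inf \<bar>x\<bar> y) < e} \<subseteq> U" by blast
  let ?V = "{x. \<forall>y\<in>Y. norm (inf \<bar>x\<bar> y) < e}"
  have "d_open ?V"
    unfolding d_open_def
  proof (intro ballI allI impI)
    fix x F assume x: "x \<in> ?V" and F: "d_converges F x"
    have "eventually (\<lambda>z. norm (inf \<bar>z\<bar> y) < e) F" if y: "y \<in> Y" for y
    proof -
      have y0: "0 \<le> y" using y Y by auto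
      have "eventually (\<lambda>z. norm (inf \<bar>z - x\<bar> y) < e - norm (inf \<bar>x\<bar> y)) F"
        using F x y y0 by (intro order_tendstoD) (auto simp: d_converges_def)
      then show ?thesis
      proof (rule eventually_mono)
        fix z assume z: "norm (inf \<bar>z - x\<bar> y) < e - norm (inf \<bar>x\<bar> y)"
        have "\<bar>z\<bar> \<le> \<bar>z - x\<bar> + \<bar>x\<bar>" using abs_triangle_ineq[of "z - x" x] by simp
        then have "inf \<bar>z\<bar> y \<le> inf (\<bar>z - x\<bar> + \<bar>x\<bar>) y" by (rule inf_mono) simp
        also have "\<dots> \<le> inf \<bar>z - x\<bar> y + inf \<bar>x\<bar> y"
          using y0 by (intro inf_add_le_inf) auto
        finally have "norm (inf \<bar>z\<bar> y) \<le> norm (inf \<bar>z - x\<bar> y + inf \<bar>x\<bar> y)"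
          using y0 by (intro norm_mono) (simp add: abs_of_nonneg)
        also have "\<dots> \<le> norm (inf \<bar>z - x\<bar> y) + norm (inf \<bar>x\<bar> y)" by (rule norm_triangle_ineq)
        finally show "norm (inf \<bar>z\<bar> y) < e" using z by simp
      qed
    qed
    then show "eventually (\<lambda>z. z \<in> ?V) F"
      using Y by (simp add: eventually_ball_finite_distrib)
  qed
  moreover have "0 \<in> ?V" using Y by (auto simp: inf_absorb1)
  ultimately show "d_neighbourhood_0 U"
    using sub by (auto simp: d_neighbourhood_0_def openin_d_topology)
qed


section \<open>Nonstandard universes\<close>

text \<open>The standard universe is a superstructure truncated at a finite level, realised on a
  type \<open>'u\<close> with membership relation \<open>mem\<close>; the full superstructure is the union of these, and no
  HOL type is provably large enough to carry it. The maps \<open>pt\<close> and \<open>num\<close> place the Banach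
  lattice \<open>'e\<close> and the reals in it. The type \<open>'v\<close> is the nonstandard extension of the whole
  truncated superstructure, i.e. all of its elements are internal. The map \<open>star_rel\<close> sends a relation
  on \<open>'u\<close> (a set of argument lists) to its extension, and \<open>star_elem\<close> sends a standard
  object \<open>a\<close> to its image \<open>*a\<close>.\<close>

record ('e, 'u, 'v) nonstandard =
  mem :: "'u \<Rightarrow> 'u \<Rightarrow> bool"
  pt :: "'e \<Rightarrow> 'u"
  num :: "real \<Rightarrow> 'u"
  star_rel :: "'u list set \<Rightarrow> 'v list set"
  star_elem :: "'u \<Rightarrow> 'v"

subsection \<open>Superstructures\<close>

primrec level :: "('u \<Rightarrow> 'u \<Rightarrow> bool) \<Rightarrow> 'u set \<Rightarrow> nat \<Rightarrow> 'u set" where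
  "level m B 0 = B"
| "level m B (Suc k) = B \<union> {A. A \<notin> B \<and> {a. m a A} \<subseteq> level m B k}"

definition superstructure :: "('u \<Rightarrow> 'u \<Rightarrow> bool) \<Rightarrow> 'u set \<Rightarrow> nat \<Rightarrow> bool" where
  "superstructure m B n \<longleftrightarrow>
     (\<forall>b\<in>B. \<forall>a. \<not> m a b) \<and>
     (\<forall>A C. A \<notin> B \<and> C \<notin> B \<and> (\<forall>a. m a A \<longleftrightarrow> m a C) \<longrightarrow> A = C) \<and>
     (\<forall>k<n. \<forall>S. S \<subseteq> level m B k \<longrightarrow> (\<exists>A. A \<notin> B \<and> {a. m a A} = S)) \<and>
     level m B n = UNIV"

subsection \<open>Transfer\<close>

text \<open>First-order formulas with a symbol for every relation on \<open>'u\<close>. Their quantifiers range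
  over the whole type; from the point of view of the full superstructure they are bounded by the
  standard set \<open>'u\<close> and by its extension \<open>'v\<close>.\<close>

datatype 'u formula =
  Eq nat nat
| Rel "'u list set" "nat list"
| Neg "'u formula"
| Conj "'u formula" "'u formula"
| Ex nat "'u formula"

primrec sat :: "('u list set \<Rightarrow> 'a list set) \<Rightarrow> 'u formula \<Rightarrow> (nat \<Rightarrow> 'a) \<Rightarrow> bool" where
  "sat I (Eq i j) s \<longleftrightarrow> s i = s j"
| "sat I (Rel R is) s \<longleftrightarrow> map s is \<in> I R"
| "sat I (Neg \<phi>) s \<longleftrightarrow> \<not> sat I \<phi> s"
| "sat I (Conj \<phi> \<psi>) s \<longleftrightarrow> sat I \<phi> s \<and> sat I \<psi> s"
| "sat I (Ex i \<phi>) s \<longleftrightarrow> (\<exists>a. sat I \<phi> (s(i := a)))"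

definition transfer_principle :: "('e, 'u, 'v) nonstandard \<Rightarrow> bool" where
  "transfer_principle W \<longleftrightarrow>
     (\<forall>\<phi> s. sat (\<lambda>R. R) \<phi> s \<longleftrightarrow> sat (star_rel W) \<phi> (\<lambda>i. star_elem W (s i)))"

subsection \<open>Saturation\<close>

definition internal_ext :: "('e, 'u, 'v) nonstandard \<Rightarrow> 'v \<Rightarrow> 'v set" where
  "internal_ext W A = {a. [a, A] \<in> star_rel W {[b, C] | b C. mem W b C}}"

definition saturated :: "('e, 'u, 'v) nonstandard \<Rightarrow> bool" where
  "saturated W \<longleftrightarrow>
     (\<forall>(J :: 'u set) (A :: 'u \<Rightarrow> 'v).
        (\<forall>K. K \<subseteq> J \<and> finite K \<longrightarrow> (\<Inter>i\<in>K. internal_ext W (A i)) \<noteq> {}) \<longrightarrow>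
        (\<Inter>i\<in>J. internal_ext W (A i)) \<noteq> {})"

text \<open>The requirement \<open>k < n\<close> makes the Banach lattice and the reals, as well as all of their
  subsets, members of the universe.\<close>

definition nonstandard_universe :: "('e, 'u, 'v) nonstandard \<Rightarrow> bool" where
  "nonstandard_universe W \<longleftrightarrow>
     (\<exists>B n. superstructure (mem W) B n \<and>
        (\<exists>k<n. range (pt W) \<union> range (num W) \<subseteq> level (mem W) B k)) \<and>
     inj (pt W) \<and> inj (num W) \<and>
     transfer_principle W \<and> saturated W"


section \<open>The nonstandard extension of a Banach lattice\<close>

definition star_set :: "('e, 'u, 'v) nonstandard \<Rightarrow> 'e set \<Rightarrow> 'v set" where
  "star_set W U = {x. [x] \<in> star_rel W {[pt W a] | a. a \<in> U}}"

abbreviation star_space :: "('e, 'u, 'v) nonstandard \<Rightarrow> 'v set" where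
  "star_space W \<equiv> star_set W UNIV"

abbreviation star_pt :: "('e, 'u, 'v) nonstandard \<Rightarrow> 'e \<Rightarrow> 'v" where
  "star_pt W a \<equiv> star_elem W (pt W a)"

abbreviation star_num :: "('e, 'u, 'v) nonstandard \<Rightarrow> real \<Rightarrow> 'v" where
  "star_num W r \<equiv> star_elem W (num W r)"

text \<open>The value at \<open>xs\<close> of the extension of the (partial) function whose graph is \<open>G\<close>.\<close>

definition star_app :: "('e, 'u, 'v) nonstandard \<Rightarrow> 'u list set \<Rightarrow> 'v list \<Rightarrow> 'v" where
  "star_app W G xs = (THE z. xs @ [z] \<in> star_rel W G)"

definition star_minus :: "('e::banach_lattice, 'u, 'v) nonstandard \<Rightarrow> 'v \<Rightarrow> 'v \<Rightarrow> 'v" where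
  "star_minus W x y = star_app W {[pt W a, pt W b, pt W (a - b)] | a b. True} [x, y]"

definition star_abs :: "('e::banach_lattice, 'u, 'v) nonstandard \<Rightarrow> 'v \<Rightarrow> 'v" where
  "star_abs W x = star_app W {[pt W a, pt W \<bar>a\<bar>] | a. True} [x]"

definition star_inf :: "('e::banach_lattice, 'u, 'v) nonstandard \<Rightarrow> 'v \<Rightarrow> 'v \<Rightarrow> 'v" where
  "star_inf W x y = star_app W {[pt W a, pt W b, pt W (inf a b)] | a b. True} [x, y]"

definition star_le :: "('e::banach_lattice, 'u, 'v) nonstandard \<Rightarrow> 'v \<Rightarrow> 'v \<Rightarrow> bool" where
  "star_le W x y \<longleftrightarrow> [x, y] \<in> star_rel W {[pt W a, pt W b] | a b. a \<le> b}"

definition star_norm :: "('e::banach_lattice, 'u, 'v) nonstandard \<Rightarrow> 'v \<Rightarrow> 'v" where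
  "star_norm W x = star_app W {[pt W a, num W (norm a)] | a. True} [x]"

definition hyperreal_less :: "('e, 'u, 'v) nonstandard \<Rightarrow> 'v \<Rightarrow> 'v \<Rightarrow> bool" where
  "hyperreal_less W r s \<longleftrightarrow> [r, s] \<in> star_rel W {[num W a, num W b] | a b. a < b}"

definition infinitesimal :: "('e, 'u, 'v) nonstandard \<Rightarrow> 'v \<Rightarrow> bool" where
  "infinitesimal W r \<longleftrightarrow>
     (\<forall>\<epsilon>>0. hyperreal_less W (star_num W (- \<epsilon>)) r \<and> hyperreal_less W r (star_num W \<epsilon>))"

definition fin :: "('e::banach_lattice, 'u, 'v) nonstandard \<Rightarrow> 'v set" where
  "fin W = {x \<in> star_space W. \<exists>r. hyperreal_less W (star_norm W x) (star_num W r)}"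

definition monad_0 :: "('e::banach_lattice, 'u, 'v) nonstandard \<Rightarrow> 'v set" where
  "monad_0 W = {x \<in> star_space W. infinitesimal W (star_norm W x)}"

definition approx :: "('e::banach_lattice, 'u, 'v) nonstandard \<Rightarrow> 'v \<Rightarrow> 'v \<Rightarrow> bool" where
  "approx W x y \<longleftrightarrow> infinitesimal W (star_norm W (star_minus W x y))"

definition d_monad_0 :: "('e::banach_lattice, 'u, 'v) nonstandard \<Rightarrow> 'v set" where
  "d_monad_0 W = (\<Inter>U\<in>{U. d_neighbourhood_0 U}. star_set W U)"


section \<open>The nonstandard hull\<close>

definition hull_rel :: "('e::banach_lattice, 'u, 'v) nonstandard \<Rightarrow> ('v \<times> 'v) set" where
  "hull_rel W = {(x, y). x \<in> fin W \<and> y \<in> fin W \<and> star_minus W x y \<in> monad_0 W}"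

definition nonstd_hull :: "('e::banach_lattice, 'u, 'v) nonstandard \<Rightarrow> 'v set set" where
  "nonstd_hull W = fin W // hull_rel W"

definition hat :: "('e::banach_lattice, 'u, 'v) nonstandard \<Rightarrow> 'v \<Rightarrow> 'v set" where
  "hat W x = hull_rel W `` {x}"

text \<open>The absolute value is the one induced on classes; the union is over equal sets. The order
  is the quotient order, and the meet is the greatest lower bound for it.\<close>

definition hull_abs :: "('e::banach_lattice, 'u, 'v) nonstandard \<Rightarrow> 'v set \<Rightarrow> 'v set" where
  "hull_abs W \<xi> = (\<Union>x\<in>\<xi>. hat W (star_abs W x))"

definition hull_le :: "('e::banach_lattice, 'u, 'v) nonstandard \<Rightarrow> 'v set \<Rightarrow> 'v set \<Rightarrow> bool" where
  "hull_le W \<xi> \<eta> \<longleftrightarrow> (\<exists>x\<in>\<xi>. \<exists>y\<in>\<eta>. star_le W x y)"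

definition hull_inf :: "('e::banach_lattice, 'u, 'v) nonstandard \<Rightarrow> 'v set \<Rightarrow> 'v set \<Rightarrow> 'v set" where
  "hull_inf W \<xi> \<eta> = (THE \<zeta>. \<zeta> \<in> nonstd_hull W \<and> hull_le W \<zeta> \<xi> \<and> hull_le W \<zeta> \<eta> \<and>
     (\<forall>\<omega>\<in>nonstd_hull W. hull_le W \<omega> \<xi> \<and> hull_le W \<omega> \<eta> \<longrightarrow> hull_le W \<omega> \<zeta>))"

definition disjoint_complement :: "('e::banach_lattice, 'u, 'v) nonstandard \<Rightarrow> 'v set set" where
  "disjoint_complement W = {\<xi> \<in> nonstd_hull W. \<forall>y.
     hull_inf W (hull_abs W \<xi>) (hull_abs W (hat W (star_pt W y))) = hat W (star_pt W 0)}"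

end

theory Submission
  imports Defs
begin

text \<open>Transfer makes the conditions \<open>map h xs \<in> R\<close> on selections \<open>h :: 'v \<Rightarrow> 'u\<close>, taken over all true
  statements \<open>xs \<in> *R\<close>, finitely satisfiable. They generate a proper filter along which a
  statement about elements of the nonstandard universe holds iff it eventually holds for the
  values selected for them, as in an ultrapower. A point of \<open>*E\<close> thus becomes an
  \<open>E\<close>-valued function, being infinitesimal becomes convergence to \<open>0\<close> along the filter, and each of
  the three conditions becomes \<open>inf \<bar>x\<bar> y \<longlongrightarrow> 0\<close> for all \<open>y \<ge> 0\<close>. For the second one, the meet of
  the classes of \<open>u\<close> and \<open>v\<close> in the hull is the class of \<open>inf u v\<close>, because lattice operations are
  nonexpansive.\<close>

section \<open>Lattice operations and the norm\<close>

lemma norm_abs [simp]: "norm \<bar>x\<bar> = norm (x :: 'e::banach_lattice)"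
  by (intro antisym norm_mono) simp_all

lemma norm_mono_nonneg: "0 \<le> x \<Longrightarrow> x \<le> y \<Longrightarrow> norm x \<le> norm (y :: 'e::banach_lattice)"
  by (rule norm_mono) (simp add: abs_of_nonneg)

text \<open>Put \<open>e = \<bar>a - c\<bar> + \<bar>b - d\<bar>\<close>. Then
  \<open>a \<le> c + e\<close> and \<open>b \<le> d + e\<close>, and translation by \<open>e\<close>
  commutes with meets.\<close>

lemma inf_diff_le:
  fixes a b c d :: "'e::lattice_ab_group_add_abs"
  shows "inf a b - inf c d \<le> \<bar>a - c\<bar> + \<bar>b - d\<bar>"
proof -
  let ?e = "\<bar>a - c\<bar> + \<bar>b - d\<bar>"
  have "a - c \<le> ?e" by (rule order_trans[OF abs_ge_self]) simp
  moreover have "b - d \<le> ?e" by (rule order_trans[OF abs_ge_self]) simp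
  ultimately have "inf a b \<le> inf (c + ?e) (d + ?e)"
    by (intro inf_mono) (simp_all add: diff_le_eq add.commute)
  also have "\<dots> = inf c d + ?e" by (rule add_inf_distrib_right[symmetric])
  finally show ?thesis by (simp only: diff_le_eq add.commute)
qed

lemma norm_inf_diff_le:
  fixes a b c d :: "'e::banach_lattice"
  shows "norm (inf a b - inf c d) \<le> norm (a - c) + norm (b - d)"
proof -
  have "\<bar>inf a b - inf c d\<bar> \<le> \<bar>a - c\<bar> + \<bar>b - d\<bar>"
  proof (rule abs_leI)
    show "- (inf a b - inf c d) \<le> \<bar>a - c\<bar> + \<bar>b - d\<bar>"
      using inf_diff_le[of c d a b]
      by (simp only: minus_diff_eq abs_minus_commute[of c a] abs_minus_commute[of d b])
  qed (rule inf_diff_le)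
  then have "norm (inf a b - inf c d) \<le> norm (\<bar>a - c\<bar> + \<bar>b - d\<bar>)"
    by (intro norm_mono) (simp add: abs_of_nonneg)
  also have "\<dots> \<le> norm (a - c) + norm (b - d)"
    by (rule order_trans[OF norm_triangle_ineq]) simp
  finally show ?thesis .
qed

lemma norm_abs_diff_le:
  fixes a b :: "'e::banach_lattice"
  shows "norm (\<bar>a\<bar> - \<bar>b\<bar>) \<le> norm (a - b)"
  by (rule norm_mono) (rule abs_triangle_ineq3)


section \<open>Filters of selections\<close>

text \<open>Universal closure of the first \<open>n\<close> variables, written with
  \<open>Neg\<close> and \<open>Ex\<close> since formulas have no universal quantifier.\<close>

definition forall_below :: "nat \<Rightarrow> 'u formula \<Rightarrow> 'u formula" where
  "forall_below n \<phi> = foldr (\<lambda>i \<psi>. Neg (Ex i (Neg \<psi>))) [0..<n] \<phi>"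

lemma sat_forall_below:
  "sat I (forall_below n \<phi>) s \<longleftrightarrow> (\<forall>t. sat I \<phi> (\<lambda>i. if i < n then t i else s i))"
proof (induction n arbitrary: \<phi>)
  case 0
  then show ?case by (simp add: forall_below_def)
next
  case (Suc n)
  have upd: "(\<lambda>i. if i < n then t i else s i)(n := a) =
      (\<lambda>i. if i < Suc n then (t(n := a)) i else s i)" for t a
    by (auto simp: fun_eq_iff)
  \<comment> \<open>In \<open>[0..<Suc n]\<close> the new index comes last, so its quantifier is
    innermost and is absorbed into the formula of the induction hypothesis.\<close>
  have "sat I (forall_below (Suc n) \<phi>) s \<longleftrightarrow>
      (\<forall>t a. sat I \<phi> ((\<lambda>i. if i < n then t i else s i)(n := a)))"
    using Suc[of "Neg (Ex n (Neg \<phi>))"] by (simp add: forall_below_def)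
  also have "\<dots> \<longleftrightarrow> (\<forall>t. sat I \<phi> (\<lambda>i. if i < Suc n then t i else s i))"
    unfolding upd by (metis fun_upd_triv)
  finally show ?case .
qed

text \<open>\<open>Eq 0 0\<close> serves as truth, the empty conjunction.\<close>

definition conj_list :: "'u formula list \<Rightarrow> 'u formula" where
  "conj_list \<phi>s = foldr Conj \<phi>s (Eq 0 0)"

lemma sat_conj_list: "sat I (conj_list \<phi>s) s \<longleftrightarrow> (\<forall>\<phi>\<in>set \<phi>s. sat I \<phi> s)"
  by (induction \<phi>s) (auto simp: conj_list_def)

definition selections :: "('e, 'u, 'v) nonstandard \<Rightarrow> ('v \<Rightarrow> 'u) filter" where
  "selections W = (INF (xs, R)\<in>{(xs, R). xs \<in> star_rel W R}. principal {h. map h xs \<in> R})"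

text \<open>Off the range of \<open>pt W\<close> the value is arbitrary; for points of
  \<open>*E\<close> the selected values eventually avoid that case.\<close>

definition coord :: "('e, 'u, 'v) nonstandard \<Rightarrow> 'v \<Rightarrow> ('v \<Rightarrow> 'u) \<Rightarrow> 'e" where
  "coord W x h = inv (pt W) (h x)"

locale nonstandard_extension =
  fixes W :: "('e::banach_lattice, 'u, 'v) nonstandard"
  assumes transfer: "transfer_principle W"
    and inj_pt: "inj (pt W)"
    and inj_num: "inj (num W)"
begin

abbreviation "\<F> \<equiv> selections W"

text \<open>Transfer itself only admits assignments with standard values
  \<open>star_elem W a\<close>. Transferring the universal closure frees the variables below
  \<open>n\<close> to take arbitrary values in \<open>'v\<close>.\<close>

lemma transfer_forall:
  assumes "\<And>s. sat (\<lambda>R. R) \<phi> s"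
  shows "sat (star_rel W) \<phi> (\<lambda>i. if i < n then t i else star_elem W undefined)"
proof -
  have "sat (\<lambda>R. R) (forall_below n \<phi>) (\<lambda>_. undefined)"
    using assms by (simp add: sat_forall_below)
  then have "sat (star_rel W) (forall_below n \<phi>) (\<lambda>_. star_elem W undefined)"
    using transfer by (simp add: transfer_principle_def)
  then show ?thesis by (simp add: sat_forall_below)
qed

text \<open>If no selection met all conditions, the standard universe would satisfy the negated
  conjunction for every assignment. By transfer it would then fail at the very points occurring in
  \<open>X\<close>, where it holds by hypothesis. Finitely many variables suffice to name these
  points.\<close>

lemma finite_selection:
  assumes "finite X" and X: "\<And>xs R. (xs, R) \<in> X \<Longrightarrow> xs \<in> star_rel W R"
  shows "\<exists>h. \<forall>(xs, R)\<in>X. map h xs \<in> R"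
proof (rule ccontr)
  assume none: "\<nexists>h. \<forall>(xs, R)\<in>X. map h xs \<in> R"
  define V where "V = (\<Union>(xs, R)\<in>X. set xs)"
  have "finite V" using \<open>finite X\<close> by (auto simp: V_def)
  then obtain idx where idx: "bij_betw idx V {0..<card V}"
    using ex_bij_betw_finite_nat by blast
  obtain L where L: "set L = X" using \<open>finite X\<close> finite_list by blast
  define \<phi> where "\<phi> = Neg (conj_list (map (\<lambda>(xs, R). Rel R (map idx xs)) L))"
  have sat_iff: "sat I \<phi> s \<longleftrightarrow> \<not> (\<forall>(xs, R)\<in>X. map (s \<circ> idx) xs \<in> I R)"
    for s :: "nat \<Rightarrow> 'z" and I
    by (auto simp: \<phi>_def sat_conj_list L case_prod_beta)
  \<comment> \<open>Each assignment \<open>s\<close> provides the candidate selection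
    \<open>s \<circ> idx\<close>.\<close>
  have "sat (\<lambda>R. R) \<phi> s" for s using none by (auto simp: sat_iff)
  then have "sat (star_rel W) \<phi>
      (\<lambda>i. if i < card V then inv_into V idx i else star_elem W undefined)"
    (is "sat _ _ ?t")
    by (rule transfer_forall)
  \<comment> \<open>Under the assignment \<open>?t\<close> every variable denotes the point it
    names.\<close>
  moreover have "map (?t \<circ> idx) xs = xs" if "(xs, R) \<in> X" for xs R
  proof (rule map_idI)
    fix x assume "x \<in> set xs"
    then have "x \<in> V" using that by (auto simp: V_def)
    then show "(?t \<circ> idx) x = x"
      using idx by (auto simp: bij_betw_def)
  qed
  ultimately show False using X by (fastforce simp: sat_iff)
qed

section \<open>A Los theorem for the filter of selections\<close>

lemma selections_neq_bot: "\<F> \<noteq> bot"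
  unfolding selections_def
proof (rule INF_filter_not_bot)
  fix X :: "('v list \<times> 'u list set) set"
  assume X: "X \<subseteq> {(xs, R). xs \<in> star_rel W R}" "finite X"
  then obtain h where "\<forall>(xs, R)\<in>X. map h xs \<in> R"
    using finite_selection[of X] by auto
  then have "h \<in> (\<Inter>p\<in>X. {h. map h (fst p) \<in> snd p})" by auto
  then have "(INF p\<in>X. principal {h. map h (fst p) \<in> snd p}) \<noteq> bot"
    unfolding INF_principal_finite[OF X(2)] principal_eq_bot_iff by blast
  then show "(INF p\<in>X. case p of (xs, R) \<Rightarrow> principal {h. map h xs \<in> R}) \<noteq> bot"
    by (simp add: case_prod_beta)
qed

lemma star_relD: "xs \<in> star_rel W R \<Longrightarrow> \<forall>\<^sub>F h in \<F>. map h xs \<in> R"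
proof -
  assume "xs \<in> star_rel W R"
  then have "\<F> \<le> (case (xs, R) of (xs, R) \<Rightarrow> principal {h. map h xs \<in> R})"
    unfolding selections_def by (intro INF_lower) simp
  then show ?thesis by (simp add: le_principal)
qed

lemma map_valuation:
  "map (\<lambda>i. if i < length xs then xs ! i else c) [0..<length xs] = xs"
  by (rule nth_equalityI) simp_all

text \<open>The filter decides each event \<open>map h xs \<in> R\<close> as an ultrafilter would:
  by transfer, \<open>xs\<close> lies in the extension of \<open>R\<close> or of its complement, and
  a proper filter cannot contain both events.\<close>

lemma star_rel_iff: "xs \<in> star_rel W R \<longleftrightarrow> (\<forall>\<^sub>F h in \<F>. map h xs \<in> R)"
proof
  assume ev: "\<forall>\<^sub>F h in \<F>. map h xs \<in> R"
  let ?is = "[0..<length xs]"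
  let ?t = "\<lambda>i. if i < length xs then xs ! i else star_elem W undefined"
  show "xs \<in> star_rel W R"
  proof (rule ccontr)
    assume "xs \<notin> star_rel W R"
    moreover have "sat (star_rel W) (Neg (Conj (Neg (Rel R ?is)) (Neg (Rel (- R) ?is)))) ?t"
      by (rule transfer_forall) simp
    ultimately have "xs \<in> star_rel W (- R)" by (simp add: map_valuation del: upt_Suc)
    from eventually_conj[OF ev star_relD[OF this]] show False
      using selections_neq_bot by (simp add: eventually_False)
  qed
qed (rule star_relD)

text \<open>By transfer, the extension of the diagonal relation contains only genuinely equal
  pairs.\<close>

lemma eventually_eq_iff: "(\<forall>\<^sub>F h in \<F>. h x = h y) \<longleftrightarrow> x = y"
proof
  assume "\<forall>\<^sub>F h in \<F>. h x = h y"
  then have xy: "[x, y] \<in> star_rel W {[a, a] | a. True}" by (simp add: star_rel_iff eq_commute)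
  have "sat (star_rel W) (Neg (Conj (Rel {[a, a] | a. True} [0, 1]) (Neg (Eq 0 1))))
      (\<lambda>i. if i < 2 then [x, y] ! i else star_elem W undefined)"
    by (rule transfer_forall) simp
  with xy show "x = y" by simp
qed simp

lemma eventually_star_elem: "\<forall>\<^sub>F h in \<F>. h (star_elem W a) = a"
proof -
  have "sat (\<lambda>R. R) (Rel {[a]} [0]) (\<lambda>_. a)" by simp
  then have "sat (star_rel W) (Rel {[a]} [0]) (\<lambda>_. star_elem W a)"
    using transfer[unfolded transfer_principle_def, rule_format, of "Rel {[a]} [0]" "\<lambda>_. a"] by simp
  then have "[star_elem W a] \<in> star_rel W {[a]}" by simp
  then show ?thesis by (simp add: star_rel_iff)
qed

text \<open>The graph need only be functional at the selected arguments, eventually. Existence of a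
  value transfers from the standard domain of \<open>G\<close>; two values are eventually selected
  alike and hence equal.\<close>

lemma eventually_star_app:
  assumes "\<forall>\<^sub>F h in \<F>. \<forall>b. map h xs @ [b] \<in> G \<longleftrightarrow> b = f h"
  shows "\<forall>\<^sub>F h in \<F>. h (star_app W G xs) = f h"
proof -
  let ?n = "length xs"
  \<comment> \<open>The domain of the partial function with graph \<open>G\<close>.\<close>
  let ?S = "{as. \<exists>b. as @ [b] \<in> G}"
  let ?t = "\<lambda>i. if i < ?n then xs ! i else star_elem W undefined"
  have upd: "map (s(?n := b)) [0..<?n] = map s [0..<?n]" for s :: "nat \<Rightarrow> 'z" and b
    by simp
  have "\<forall>\<^sub>F h in \<F>. map h xs \<in> ?S" using assms by eventually_elim auto
  then have "xs \<in> star_rel W ?S" by (simp add: star_rel_iff)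
  moreover have "sat (star_rel W)
      (Neg (Conj (Rel ?S [0..<?n]) (Neg (Ex ?n (Rel G ([0..<?n] @ [?n])))))) ?t"
    by (rule transfer_forall) (auto simp: upd)
  ultimately obtain z where z: "xs @ [z] \<in> star_rel W G"
    by (auto simp: upd map_valuation)
  have sel: "\<forall>\<^sub>F h in \<F>. h z' = f h" if "xs @ [z'] \<in> star_rel W G" for z'
    using assms star_relD[OF that] by eventually_elim simp
  have "star_app W G xs = z"
    unfolding star_app_def
  proof (rule the_equality)
    fix z' assume "xs @ [z'] \<in> star_rel W G"
    from sel[OF this] sel[OF z] have "\<forall>\<^sub>F h in \<F>. h z' = h z"
      by eventually_elim simp
    then show "z' = z" by (simp add: eventually_eq_iff)
  qed (rule z)
  with sel[OF z] show ?thesis by simp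
qed


section \<open>Coordinates of points of \<open>*E\<close>\<close>

lemma coord_eqI: "h x = pt W a \<Longrightarrow> coord W x h = a"
  by (simp add: coord_def inv_f_f[OF inj_pt])

lemma mem_star_set_iff: "x \<in> star_set W U \<longleftrightarrow> (\<forall>\<^sub>F h in \<F>. h x \<in> pt W ` U)"
  by (simp add: star_set_def star_rel_iff image_def Bex_def conj_commute)

lemma eventually_pt_coord:
  "x \<in> star_space W \<Longrightarrow> \<forall>\<^sub>F h in \<F>. h x = pt W (coord W x h)"
  unfolding mem_star_set_iff by (erule eventually_mono) (auto simp: coord_eqI)

lemma star_spaceI: "\<forall>\<^sub>F h in \<F>. h x = pt W (f h) \<Longrightarrow> x \<in> star_space W"
  unfolding mem_star_set_iff by (erule eventually_mono) auto

lemma eventually_coordI: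
  "\<forall>\<^sub>F h in \<F>. h x = pt W (f h) \<Longrightarrow> \<forall>\<^sub>F h in \<F>. coord W x h = f h"
  by (erule eventually_mono) (rule coord_eqI)

lemma star_set_iff_coord:
  assumes "x \<in> star_space W"
  shows "x \<in> star_set W U \<longleftrightarrow> (\<forall>\<^sub>F h in \<F>. coord W x h \<in> U)"
  unfolding mem_star_set_iff
  by (rule eventually_cong[OF eventually_pt_coord[OF assms]])
    (simp add: inj_image_mem_iff[OF inj_pt])

lemma star_pt_in_space: "star_pt W a \<in> star_space W"
  by (rule star_spaceI[OF eventually_star_elem])

lemma coord_star_pt: "\<forall>\<^sub>F h in \<F>. coord W (star_pt W a) h = a"
  by (rule eventually_coordI[OF eventually_star_elem])

text \<open>The values of \<open>g\<close> lie in the universe \<open>'u\<close>, so that the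
  real-valued norm is covered along with operations into \<open>E\<close>.\<close>

lemma eventually_star_app1:
  assumes "x \<in> star_space W"
  shows "\<forall>\<^sub>F h in \<F>. h (star_app W {[pt W a, g a] | a. True} [x]) = g (coord W x h)"
  by (rule eventually_star_app, rule eventually_mono[OF eventually_pt_coord[OF assms]])
    (auto simp: inj_eq[OF inj_pt] coord_def inv_f_f[OF inj_pt])

lemma eventually_star_app2:
  assumes "x \<in> star_space W" "y \<in> star_space W"
  shows "\<forall>\<^sub>F h in \<F>. h (star_app W {[pt W a, pt W b, g a b] | a b. True} [x, y]) =
    g (coord W x h) (coord W y h)"
  by (rule eventually_star_app,
      rule eventually_elim2[OF eventually_pt_coord[OF assms(1)] eventually_pt_coord[OF assms(2)]])
    (auto simp: inj_eq[OF inj_pt] coord_def inv_f_f[OF inj_pt])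

lemmas eventually_star_abs =
  eventually_star_app1[where g = "\<lambda>a. pt W \<bar>a\<bar>", folded star_abs_def]
lemmas eventually_star_norm =
  eventually_star_app1[where g = "\<lambda>a. num W (norm a)", folded star_norm_def]
lemmas eventually_star_minus =
  eventually_star_app2[where g = "\<lambda>a b. pt W (a - b)", folded star_minus_def]
lemmas eventually_star_inf =
  eventually_star_app2[where g = "\<lambda>a b. pt W (inf a b)", folded star_inf_def]

lemmas star_abs_in_space = star_spaceI[OF eventually_star_abs]
lemmas star_minus_in_space = star_spaceI[OF eventually_star_minus]
lemmas star_inf_in_space = star_spaceI[OF eventually_star_inf]

lemmas coord_star_abs = eventually_coordI[OF eventually_star_abs]
lemmas coord_star_minus = eventually_coordI[OF eventually_star_minus]
lemmas coord_star_inf = eventually_coordI[OF eventually_star_inf]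

section \<open>Order, infinitesimals and finiteness in coordinates\<close>

lemma star_le_iff_coord:
  assumes "x \<in> star_space W" "y \<in> star_space W"
  shows "star_le W x y \<longleftrightarrow> (\<forall>\<^sub>F h in \<F>. coord W x h \<le> coord W y h)"
  unfolding star_le_def star_rel_iff
  by (rule eventually_cong[OF eventually_conj[OF eventually_pt_coord[OF assms(1)]
          eventually_pt_coord[OF assms(2)]]])
    (auto simp: inj_eq[OF inj_pt] coord_def inv_f_f[OF inj_pt])

text \<open>Hyperreals have no coordinate map here; \<open>f\<close> and \<open>g\<close> stand for
  norms of coordinates or constants.\<close>

lemma hyperreal_less_iff:
  assumes "\<forall>\<^sub>F h in \<F>. h r = num W (f h)" "\<forall>\<^sub>F h in \<F>. h s = num W (g h)"
  shows "hyperreal_less W r s \<longleftrightarrow> (\<forall>\<^sub>F h in \<F>. f h < g h)"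
  unfolding hyperreal_less_def star_rel_iff
  by (rule eventually_cong[OF eventually_conj[OF assms]]) (auto simp: inj_eq[OF inj_num])

lemma infinitesimal_norm_iff:
  assumes "x \<in> star_space W"
  shows "infinitesimal W (star_norm W x) \<longleftrightarrow> (coord W x \<longlongrightarrow> 0) \<F>"
proof -
  note less = hyperreal_less_iff[OF eventually_star_norm[OF assms] eventually_star_elem]
    hyperreal_less_iff[OF eventually_star_elem eventually_star_norm[OF assms]]
  \<comment> \<open>The lower bound is automatic for norms; the upper one is the definition of
    convergence to \<open>0\<close>.\<close>
  have "- \<epsilon> < norm a" if "\<epsilon> > 0" for \<epsilon> and a :: 'e
    using that norm_ge_zero[of a] by linarith
  then show ?thesis
    by (simp add: infinitesimal_def less tendsto_iff)
qed

lemma fin_iff: "x \<in> fin W \<longleftrightarrow> x \<in> star_space W \<and> (\<exists>r. \<forall>\<^sub>F h in \<F>. norm (coord W x h) < r)"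
  by (auto simp: fin_def hyperreal_less_iff[OF eventually_star_norm eventually_star_elem])

lemma fin_in_space: "x \<in> fin W \<Longrightarrow> x \<in> star_space W"
  by (simp add: fin_iff)

lemma star_pt_in_fin: "star_pt W a \<in> fin W"
  unfolding fin_iff
proof (intro conjI exI)
  show "\<forall>\<^sub>F h in \<F>. norm (coord W (star_pt W a) h) < norm a + 1"
    using coord_star_pt[of a] by eventually_elim simp
qed (rule star_pt_in_space)

lemma star_abs_in_fin: "x \<in> fin W \<Longrightarrow> star_abs W x \<in> fin W"
proof -
  assume x: "x \<in> fin W"
  then obtain r where "\<forall>\<^sub>F h in \<F>. norm (coord W x h) < r" by (auto simp: fin_iff)
  with coord_star_abs[OF fin_in_space[OF x]]
  have "\<forall>\<^sub>F h in \<F>. norm (coord W (star_abs W x) h) < r" by eventually_elim simp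
  with x show ?thesis by (auto simp: fin_iff star_abs_in_space)
qed

lemma star_inf_in_fin:
  assumes x: "x \<in> fin W" and y: "y \<in> fin W"
  shows "star_inf W x y \<in> fin W"
proof -
  from x y obtain r s where "\<forall>\<^sub>F h in \<F>. norm (coord W x h) < r"
    "\<forall>\<^sub>F h in \<F>. norm (coord W y h) < s" by (auto simp: fin_iff)
  with coord_star_inf[OF fin_in_space[OF x] fin_in_space[OF y]]
  have "\<forall>\<^sub>F h in \<F>. norm (coord W (star_inf W x y) h) < r + s"
  proof eventually_elim
    case (elim h)
    \<comment> \<open>Comparison with \<open>inf 0 0 = 0\<close> bounds the norm of the
      meet.\<close>
    then show ?case
      using norm_inf_diff_le[of "coord W x h" "coord W y h" 0 0] by simp
  qed
  with x y show ?thesis by (auto simp: fin_iff star_inf_in_space)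
qed


section \<open>The nonstandard hull\<close>

text \<open>Infinitesimal distance read in coordinates. In this form the equivalence laws are limit
  laws and need no membership in \<open>*E\<close>.\<close>

definition near :: "'v \<Rightarrow> 'v \<Rightarrow> bool" where
  "near x y \<longleftrightarrow> ((\<lambda>h. coord W x h - coord W y h) \<longlongrightarrow> 0) \<F>"

lemma approx_iff_near:
  assumes "x \<in> star_space W" "y \<in> star_space W"
  shows "approx W x y \<longleftrightarrow> near x y"
  unfolding approx_def near_def infinitesimal_norm_iff[OF star_minus_in_space[OF assms]]
  by (rule tendsto_cong[OF coord_star_minus[OF assms]])

lemma near_refl: "near x x"
  by (simp add: near_def)

lemma near_sym: "near x y \<Longrightarrow> near y x"
  unfolding near_def using tendsto_minus by fastforce

lemma near_trans: "near x y \<Longrightarrow> near y z \<Longrightarrow> near x z"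
  unfolding near_def using tendsto_add by fastforce

text \<open>A squeeze argument. It turns nonexpansive operations into operations compatible with
  \<open>near\<close>; unary ones use \<open>near_refl\<close> for the second pair.\<close>

lemma near_dominated:
  assumes "near x x'" "near y y'"
    and "\<forall>\<^sub>F h in \<F>. norm (coord W u h - coord W v h)
      \<le> norm (coord W x h - coord W x' h) + norm (coord W y h - coord W y' h)"
  shows "near u v"
  unfolding near_def
proof (rule Lim_null_comparison[OF assms(3)])
  show "((\<lambda>h. norm (coord W x h - coord W x' h) + norm (coord W y h - coord W y' h)) \<longlongrightarrow> 0) \<F>"
    using assms(1,2) unfolding near_def by (intro tendsto_add_zero tendsto_norm_zero)
qed

lemma near_star_abs:
  assumes "x \<in> star_space W" "y \<in> star_space W" "near x y"
  shows "near (star_abs W x) (star_abs W y)"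
  by (rule near_dominated[OF assms(3) near_refl[of x]],
      rule eventually_elim2[OF coord_star_abs[OF assms(1)] coord_star_abs[OF assms(2)]])
    (simp add: norm_abs_diff_le)

lemma near_star_inf:
  assumes "x \<in> star_space W" "x' \<in> star_space W" "y \<in> star_space W" "y' \<in> star_space W"
    and "near x x'" "near y y'"
  shows "near (star_inf W x y) (star_inf W x' y')"
  by (rule near_dominated[OF assms(5,6)],
      rule eventually_elim2[OF coord_star_inf[OF assms(1,3)] coord_star_inf[OF assms(2,4)]])
    (simp only: norm_inf_diff_le)

text \<open>Antisymmetry up to infinitesimals: eventually
  \<open>0 \<le> y - x \<le> (x' - x) + (y - y')\<close>, because
  \<open>y' \<le> x'\<close>.\<close>

lemma near_sandwich:
  assumes "near x x'" "near y y'"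
    and "\<forall>\<^sub>F h in \<F>. coord W x h \<le> coord W y h" "\<forall>\<^sub>F h in \<F>. coord W y' h \<le> coord W x' h"
  shows "near x y"
proof -
  have "near y x"
  proof (rule near_dominated[OF near_sym[OF assms(1)] assms(2)])
    show "\<forall>\<^sub>F h in \<F>. norm (coord W y h - coord W x h)
        \<le> norm (coord W x' h - coord W x h) + norm (coord W y h - coord W y' h)"
      using assms(3,4)
    proof eventually_elim
      case (elim h)
      have "coord W y h - coord W x h
          \<le> coord W y h - coord W x h + (coord W x' h - coord W y' h)"
        using elim(2) by simp
      also have "\<dots> = (coord W x' h - coord W x h) + (coord W y h - coord W y' h)" by simp
      finally have "norm (coord W y h - coord W x h)
          \<le> norm ((coord W x' h - coord W x h) + (coord W y h - coord W y' h))"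
        using elim(1) by (intro norm_mono_nonneg) simp_all
      then show ?case by (rule order_trans[OF _ norm_triangle_ineq])
    qed
  qed
  then show ?thesis by (rule near_sym)
qed

section \<open>Classes, order and meets in the hull\<close>

lemma hull_rel_iff: "(x, y) \<in> hull_rel W \<longleftrightarrow> x \<in> fin W \<and> y \<in> fin W \<and> near x y"
  using approx_iff_near[of x y] star_minus_in_space[of x y]
  by (auto simp: hull_rel_def monad_0_def approx_def fin_in_space)

lemma equiv_hull_rel: "equiv (fin W) (hull_rel W)"
  by (rule equivI)
    (auto simp: hull_rel_iff refl_on_def sym_def trans_def intro: near_refl near_sym near_trans)

lemma mem_hat_iff: "x \<in> fin W \<Longrightarrow> y \<in> hat W x \<longleftrightarrow> y \<in> fin W \<and> near x y"
  by (simp add: hat_def hull_rel_iff)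

lemma hat_eq_iff: "x \<in> fin W \<Longrightarrow> y \<in> fin W \<Longrightarrow> hat W x = hat W y \<longleftrightarrow> near x y"
  unfolding hat_def by (simp add: eq_equiv_class_iff[OF equiv_hull_rel] hull_rel_iff)

lemma hat_in_hull: "x \<in> fin W \<Longrightarrow> hat W x \<in> nonstd_hull W"
  by (simp add: nonstd_hull_def hat_def quotientI)

lemma hullE:
  assumes "\<xi> \<in> nonstd_hull W"
  obtains x where "x \<in> fin W" "\<xi> = hat W x"
  using assms by (auto simp: nonstd_hull_def hat_def elim: quotientE)

lemma hull_abs_hat:
  assumes x: "x \<in> fin W"
  shows "hull_abs W (hat W x) = hat W (star_abs W x)"
proof -
  have "hat W (star_abs W x') = hat W (star_abs W x)" if "x' \<in> hat W x" for x'
  proof -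
    from that x have x': "x' \<in> fin W" "near x' x" by (simp_all add: mem_hat_iff near_sym)
    then have "near (star_abs W x') (star_abs W x)"
      using x by (intro near_star_abs fin_in_space)
    with x x' show ?thesis by (simp add: hat_eq_iff star_abs_in_fin)
  qed
  moreover have "x \<in> hat W x" using x by (simp add: mem_hat_iff near_refl)
  ultimately show ?thesis unfolding hull_abs_def by blast
qed

text \<open>The quotient order asks only for some comparable representatives, here \<open>u'\<close>
  and \<open>v'\<close>.\<close>

lemma hull_leI:
  assumes "u \<in> fin W" "v \<in> fin W" "u' \<in> fin W" "v' \<in> fin W" "near u u'" "near v v'"
    and "\<forall>\<^sub>F h in \<F>. coord W u' h \<le> coord W v' h"
  shows "hull_le W (hat W u) (hat W v)"
  using assms unfolding hull_le_def
  by (intro bexI[of _ u'] bexI[of _ v']) (simp_all add: mem_hat_iff star_le_iff_coord fin_in_space)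

lemma hull_leE:
  assumes "hull_le W (hat W u) (hat W v)" "u \<in> fin W" "v \<in> fin W"
  obtains u' v' where "u' \<in> fin W" "v' \<in> fin W" "near u u'" "near v v'"
    "\<forall>\<^sub>F h in \<F>. coord W u' h \<le> coord W v' h"
  using assms by (auto simp: hull_le_def mem_hat_iff star_le_iff_coord fin_in_space)

text \<open>The two inequalities come with different representatives, \<open>x1 \<le> y1\<close> and
  \<open>y2 \<le> x2\<close>, which \<open>near_sandwich\<close> reconciles.\<close>

lemma hull_le_antisym:
  assumes "\<xi> \<in> nonstd_hull W" "\<eta> \<in> nonstd_hull W" "hull_le W \<xi> \<eta>" "hull_le W \<eta> \<xi>"
  shows "\<xi> = \<eta>"
proof -
  obtain x y where x: "x \<in> fin W" "\<xi> = hat W x" and y: "y \<in> fin W" "\<eta> = hat W y"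
    using assms(1,2) by (elim hullE)
  obtain x1 y1 where 1: "near x x1" "near y y1"
    "\<forall>\<^sub>F h in \<F>. coord W x1 h \<le> coord W y1 h"
    using assms(3) x y by (auto elim: hull_leE)
  obtain x2 y2 where 2: "near x x2" "near y y2"
    "\<forall>\<^sub>F h in \<F>. coord W y2 h \<le> coord W x2 h"
    using assms(4) x y by (auto elim: hull_leE)
  have "near x1 y1"
    using near_trans[OF near_sym[OF 1(1)] 2(1)] near_trans[OF near_sym[OF 1(2)] 2(2)] 1(3) 2(3)
    by (rule near_sandwich)
  then have "near x y" using 1 near_sym near_trans by blast
  with x y show ?thesis by (simp add: hat_eq_iff)
qed

text \<open>The class of \<open>inf u v\<close> is a greatest lower bound, and antisymmetry makes it
  the only one. A lower bound \<open>w\<close> has representatives \<open>w1 \<le> u1\<close> and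
  \<open>w2 \<le> v2\<close>, so \<open>inf w1 w2 \<le> inf u1 v2\<close>.\<close>

lemma hull_inf_hat:
  assumes u: "u \<in> fin W" and v: "v \<in> fin W"
  shows "hull_inf W (hat W u) (hat W v) = hat W (star_inf W u v)"
proof -
  let ?m = "star_inf W u v"
  have m: "?m \<in> fin W" using u v by (rule star_inf_in_fin)
  note space = fin_in_space
  note coord_m = coord_star_inf[OF space[OF u] space[OF v]]
  have lower: "hull_le W (hat W ?m) (hat W u)" "hull_le W (hat W ?m) (hat W v)"
    by (rule hull_leI[OF m u m u near_refl near_refl], use coord_m in eventually_elim, simp)
      (rule hull_leI[OF m v m v near_refl near_refl], use coord_m in eventually_elim, simp)
  have greatest: "hull_le W \<omega> (hat W ?m)"
    if \<omega>: "\<omega> \<in> nonstd_hull W" "hull_le W \<omega> (hat W u)" "hull_le W \<omega> (hat W v)" for \<omega>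
  proof -
    obtain w where w: "w \<in> fin W" "\<omega> = hat W w" using \<omega>(1) by (rule hullE)
    obtain w1 u1 where 1: "w1 \<in> fin W" "u1 \<in> fin W" "near w w1" "near u u1"
      "\<forall>\<^sub>F h in \<F>. coord W w1 h \<le> coord W u1 h"
      using \<omega>(2) w u by (auto elim: hull_leE)
    obtain w2 v2 where 2: "w2 \<in> fin W" "v2 \<in> fin W" "near w w2" "near v v2"
      "\<forall>\<^sub>F h in \<F>. coord W w2 h \<le> coord W v2 h"
      using \<omega>(3) w v by (auto elim: hull_leE)
    have "near (star_inf W w w) (star_inf W w1 w2)"
      using w 1 2 by (intro near_star_inf space)
    \<comment> \<open>Since \<open>w\<close> is near \<open>inf w w\<close>, the meet of its two
      representatives still represents the class of \<open>w\<close>.\<close>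
    moreover have "near w (star_inf W w w)"
      unfolding near_def
      by (rule tendsto_eventually, use coord_star_inf[OF space space, OF w(1) w(1)]
          in eventually_elim) simp
    ultimately have "near w (star_inf W w1 w2)" using near_trans by blast
    moreover have "near ?m (star_inf W u1 v2)"
      using u v 1 2 by (intro near_star_inf space)
    moreover have "\<forall>\<^sub>F h in \<F>. coord W (star_inf W w1 w2) h \<le> coord W (star_inf W u1 v2) h"
      using coord_star_inf[OF space space, OF 1(1) 2(1)]
        coord_star_inf[OF space space, OF 1(2) 2(2)] 1(5) 2(5)
      by eventually_elim (simp add: le_infI1 le_infI2)
    ultimately show ?thesis
      unfolding w(2) using w m 1 2 by (intro hull_leI) (simp_all add: star_inf_in_fin)
  qed
  show ?thesis
    unfolding hull_inf_def
  proof (rule the_equality)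
    fix \<zeta>
    assume "\<zeta> \<in> nonstd_hull W \<and> hull_le W \<zeta> (hat W u) \<and> hull_le W \<zeta> (hat W v) \<and>
      (\<forall>\<omega>\<in>nonstd_hull W. hull_le W \<omega> (hat W u) \<and> hull_le W \<omega> (hat W v) \<longrightarrow> hull_le W \<omega> \<zeta>)"
    then show "\<zeta> = hat W ?m"
      using hat_in_hull[OF m] lower greatest by (intro hull_le_antisym) blast+
  qed (use hat_in_hull[OF m] lower greatest in blast)
qed

section \<open>The three conditions in coordinates\<close>

lemma near_zero_iff:
  assumes "x \<in> star_space W"
  shows "near (star_inf W (star_abs W x) (star_pt W y)) (star_pt W 0) \<longleftrightarrow>
    ((\<lambda>h. inf \<bar>coord W x h\<bar> y) \<longlongrightarrow> 0) \<F>"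
  unfolding near_def
  by (rule tendsto_cong, use coord_star_inf[OF star_abs_in_space[OF assms] star_pt_in_space[of y]]
      coord_star_abs[OF assms] coord_star_pt[of y] coord_star_pt[of 0] in eventually_elim) simp

lemma nearly_disjoint_iff:
  assumes "x \<in> fin W"
  shows "approx W (star_inf W (star_abs W x) (star_pt W y)) (star_pt W 0) \<longleftrightarrow>
    ((\<lambda>h. inf \<bar>coord W x h\<bar> y) \<longlongrightarrow> 0) \<F>"
  using assms near_zero_iff
  by (simp add: approx_iff_near star_inf_in_space star_abs_in_space star_pt_in_space fin_in_space)

lemma hat_in_disjoint_complement_iff:
  assumes x: "x \<in> fin W"
  shows "hat W x \<in> disjoint_complement W \<longleftrightarrow>
    (\<forall>y\<ge>0. ((\<lambda>h. inf \<bar>coord W x h\<bar> y) \<longlongrightarrow> 0) \<F>)"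
proof -
  have "hull_inf W (hull_abs W (hat W x)) (hull_abs W (hat W (star_pt W y))) = hat W (star_pt W 0)
      \<longleftrightarrow> ((\<lambda>h. inf \<bar>coord W x h\<bar> \<bar>y\<bar>) \<longlongrightarrow> 0) \<F>" for y
  proof -
    have "near (star_abs W (star_pt W y)) (star_pt W \<bar>y\<bar>)"
      unfolding near_def
      by (rule tendsto_eventually, use coord_star_abs[OF star_pt_in_space, of y] coord_star_pt[of y]
          coord_star_pt[of "\<bar>y\<bar>"] in eventually_elim) simp
    then have "hull_abs W (hat W (star_pt W y)) = hat W (star_pt W \<bar>y\<bar>)"
      by (simp add: hull_abs_hat star_pt_in_fin star_abs_in_fin hat_eq_iff)
    moreover have "hull_abs W (hat W x) = hat W (star_abs W x)" using x by (rule hull_abs_hat)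
    ultimately show ?thesis
      using x by (simp add: hull_inf_hat star_pt_in_fin star_abs_in_fin star_inf_in_fin
          hat_eq_iff near_zero_iff fin_in_space)
  qed
  then have "hat W x \<in> disjoint_complement W \<longleftrightarrow>
      (\<forall>y. ((\<lambda>h. inf \<bar>coord W x h\<bar> \<bar>y\<bar>) \<longlongrightarrow> 0) \<F>)"
    using hat_in_hull[OF x] by (simp add: disjoint_complement_def)
  \<comment> \<open>The absolute values are exactly the positive elements.\<close>
  also have "\<dots> \<longleftrightarrow> (\<forall>y\<ge>0. ((\<lambda>h. inf \<bar>coord W x h\<bar> y) \<longlongrightarrow> 0) \<F>)"
    by (metis abs_ge_zero abs_of_nonneg)
  finally show ?thesis .
qed

text \<open>Basic neighbourhoods given by a single \<open>y\<close> yield the limits. Conversely, a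
  basic neighbourhood imposes finitely many conditions, and finitely many eventual conditions hold
  eventually together.\<close>

lemma d_monad_0_iff:
  assumes x: "x \<in> fin W"
  shows "x \<in> d_monad_0 W \<longleftrightarrow> (\<forall>y\<ge>0. ((\<lambda>h. inf \<bar>coord W x h\<bar> y) \<longlongrightarrow> 0) \<F>)"
proof -
  have mem: "x \<in> d_monad_0 W \<longleftrightarrow>
      (\<forall>U. d_neighbourhood_0 U \<longrightarrow> (\<forall>\<^sub>F h in \<F>. coord W x h \<in> U))"
    by (auto simp: d_monad_0_def star_set_iff_coord[OF fin_in_space[OF x]])
  show ?thesis
    unfolding mem
  proof (intro iffI allI impI)
    fix y :: 'e
    assume all: "\<forall>U. d_neighbourhood_0 U \<longrightarrow> (\<forall>\<^sub>F h in \<F>. coord W x h \<in> U)" and y: "0 \<le> y"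
    show "((\<lambda>h. inf \<bar>coord W x h\<bar> y) \<longlongrightarrow> 0) \<F>"
    proof (rule tendstoI)
      fix e :: real assume "0 < e"
      with y have "d_neighbourhood_0 {a. norm (inf \<bar>a\<bar> y) < e}"
        unfolding d_neighbourhood_0_iff by (intro exI[of _ "{y}"] exI[of _ e]) simp
      with all show "\<forall>\<^sub>F h in \<F>. dist (inf \<bar>coord W x h\<bar> y) 0 < e" by fastforce
    qed
  next
    fix U :: "'e set"
    assume lim: "\<forall>y\<ge>0. ((\<lambda>h. inf \<bar>coord W x h\<bar> y) \<longlongrightarrow> 0) \<F>" and "d_neighbourhood_0 U"
    then obtain Y e where Y: "finite Y" "Y \<subseteq> {0..}" "e > 0"
      and sub: "{a. \<forall>y\<in>Y. norm (inf \<bar>a\<bar> y) < e} \<subseteq> U"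
      by (auto simp: d_neighbourhood_0_iff)
    have "\<forall>\<^sub>F h in \<F>. \<forall>y\<in>Y. norm (inf \<bar>coord W x h\<bar> y) < e"
      using lim Y by (intro eventually_ball_finite) (auto simp: tendsto_iff)
    then show "\<forall>\<^sub>F h in \<F>. coord W x h \<in> U"
      by (rule eventually_mono) (use sub in blast)
  qed
qed

end

theorem lemma17:
  fixes W :: "('e::banach_lattice, 'u, 'v) nonstandard" and x :: 'v
  assumes "nonstandard_universe W"
    and "x \<in> fin W"
  shows "(x \<in> d_monad_0 W \<longleftrightarrow> hat W x \<in> disjoint_complement W) \<and>
    (hat W x \<in> disjoint_complement W \<longleftrightarrow>
      (\<forall>y::'e. y \<ge> 0 \<longrightarrow> approx W (star_inf W (star_abs W x) (star_pt W y)) (star_pt W 0)))"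
proof -
  interpret nonstandard_extension W
    by standard (use assms(1) in \<open>auto simp: nonstandard_universe_def\<close>)
  show ?thesis
    using assms(2)
    by (simp add: d_monad_0_iff hat_in_disjoint_complement_iff nearly_disjoint_iff)
qed

end
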